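(* For every integer $r$ with $1\le r\le 22$ and every $n\in\mathbb{N}$, the rational number $S_r(n)$ is not an integer.
   Context: $\mathbb{N}$ denotes the set of positive integers. For $r\in\mathbb{N}$, the function $S_r:\mathbb{N}\to\mathbb{Q}$ is defined by $S_r(n)=\sum_{k=0}^{n}\frac{k}{k+r}\binom{n}{k}$. *)

theory Defs
  imports Complex_Main
begin

(* The intended domain is 1 \<le> r and 1 \<le> n; values elsewhere are irrelevant. *)
definition S :: "nat \<Rightarrow> nat \<Rightarrow> rat" where
  "S r n = (\<Sum>k=0..n. of_nat k / of_nat (k + r) * of_nat (n choose k))"

end

theory Submission
  imports Defs "HOL-Number_Theory.Number_Theory"
begin

text \<open>
  The sum is a finite difference. Writing \<open>k / (k + r) = 1 - r / (k + r)\<close>, the question becomes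
  whether \<open>r * T r n\<close> is an integer, where \<open>T r n\<close> is the sum of \<open>(n choose k) / (k + r)\<close>.
  Pascal's rule says \<open>T (r + 1) n = T r (n + 1) - T r n\<close>, and \<open>T 1 n = (2 ^ (n + 1) - 1) / (n + 1)\<close>,
  so \<open>T r n\<close> is an alternating binomial combination of the numbers \<open>(2 ^ m - 1) / m\<close>, where \<open>m\<close> runs
  through the window \<open>n + 1, ..., n + r\<close>.

  A prime \<open>p > r\<close> divides at most one \<open>m\<close> in the window and does not divide the coefficient of that
  term, so if \<open>S r n\<close> is an integer then \<open>p\<close> dividing \<open>m\<close> forces \<open>p\<close> to divide \<open>2 ^ m - 1\<close>
  (\<open>prime_dvd_mersenne_of_S_Ints\<close>). Apply this to the smallest prime factor \<open>p > r\<close> of \<open>m\<close>. The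
  order \<open>k\<close> of 2 modulo \<open>p\<close> divides both \<open>m\<close> and \<open>p - 1\<close>, so all its prime factors are at most
  \<open>r\<close>, and \<open>p\<close> divides \<open>2 ^ k - 1\<close>. If the part of \<open>m\<close> composed of primes up to \<open>r\<close> is so simple
  that \<open>k\<close> must be one of 1, 2, 3, 4, 6, 8, 12, with \<open>2 ^ k - 1\<close> having no prime factor above \<open>r\<close>,
  this is a contradiction (\<open>S_notin_Ints_of_escape\<close>).

  It remains to find such an \<open>m\<close> in every window of length \<open>r \<le> 22\<close>. For \<open>r \<le> 2\<close> an element
  without prime factors up to \<open>r\<close> will do. For \<open>r \<ge> 3\<close> the unsuitable \<open>m\<close> are the
  multiples of a few moduli: the primes from 5 to \<open>r\<close>, the number 9 (or 3) and one or two numbers of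
  the form \<open>2 ^ a\<close> or \<open>2 ^ a * 3\<close>. That the multiples of these moduli never cover a window is a finite
  statement about residues. For many lengths it follows by counting multiples; in the tight cases the
  counting is preceded by branching over the residues of \<open>n\<close> for some of the moduli
  (\<open>escapes_sound\<close>). The chosen \<open>m\<close> might itself be one of 1, 2, 3, 4, 6, 8, 12, but only if
  \<open>n < r\<close>. In that range a prime in the window is suitable if it exceeds \<open>r\<close>, and the few \<open>n\<close>
  without one are settled by estimating \<open>S r n\<close> directly (\<open>S_notin_Ints_of_less\<close>).
\<close>

section \<open>The sum as an iterated difference\<close>

definition shifted_sum :: "nat \<Rightarrow> nat \<Rightarrow> rat" where
  "shifted_sum r n = (\<Sum>k\<le>n. of_nat (n choose k) / of_nat (k + r))"

lemma S_eq_shifted_sum: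
  assumes "r \<ge> 1"
  shows "S r n = 2 ^ n - of_nat r * shifted_sum r n"
proof -
  have "S r n = (\<Sum>k\<le>n. of_nat (n choose k) - of_nat r * (of_nat (n choose k) / of_nat (k + r)))"
    unfolding S_def atLeast0AtMost
  proof (rule sum.cong)
    fix k
    have "(of_nat (k + r) :: rat) \<noteq> 0"
      using assms by simp
    then show "of_nat k / of_nat (k + r) * of_nat (n choose k) =
        (of_nat (n choose k) - of_nat r * (of_nat (n choose k) / of_nat (k + r)) :: rat)"
      by (simp add: field_simps)
  qed simp
  also have "\<dots> = of_nat (\<Sum>k\<le>n. n choose k) - of_nat r * shifted_sum r n"
    by (simp add: sum_subtractf sum_distrib_left shifted_sum_def)
  finally show ?thesis
    by (simp add: choose_row_sum)
qed

text \<open>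
  Absorption turns each summand into \<open>(n + 1 choose k + 1) / (n + 1)\<close>, so that only a row sum is left.
\<close>
lemma shifted_sum_1:
  "shifted_sum 1 n = (2 ^ (n + 1) - 1) / of_nat (n + 1)"
proof -
  have "shifted_sum 1 n = (\<Sum>k\<le>n. of_nat (Suc n choose Suc k) / of_nat (Suc n))"
    unfolding shifted_sum_def
  proof (rule sum.cong)
    fix k
    have "(of_nat (Suc n) * of_nat (n choose k) :: rat) = of_nat (Suc k) * of_nat (Suc n choose Suc k)"
      by (metis Suc_times_binomial mult.commute of_nat_mult)
    then show "of_nat (n choose k) / of_nat (k + 1) =
        (of_nat (Suc n choose Suc k) / of_nat (Suc n) :: rat)"
      by (simp add: frac_eq_eq mult.commute del: binomial_Suc_Suc of_nat_Suc)
  qed simp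
  also have "\<dots> = of_nat (\<Sum>k\<le>n. Suc n choose Suc k) / of_nat (Suc n)"
    by (simp add: sum_divide_distrib del: binomial_Suc_Suc of_nat_Suc)
  also have "of_nat (\<Sum>k\<le>n. Suc n choose Suc k) = (2 ^ (n + 1) - 1 :: rat)"
  proof -
    have "1 + (\<Sum>k\<le>n. Suc n choose Suc k) = 2 ^ Suc n"
      using choose_row_sum[of "Suc n"] by (simp only: sum.atMost_Suc_shift binomial_n_0)
    then have "of_nat (1 + (\<Sum>k\<le>n. Suc n choose Suc k)) = (of_nat (2 ^ Suc n) :: rat)"
      by (simp only:)
    then show ?thesis
      by (simp del: binomial_Suc_Suc)
  qed
  finally show ?thesis
    by simp
qed

text \<open>
  This is Pascal's rule summed over \<open>k\<close>. In terms of the integral of \<open>x ^ (r - 1) * (1 + x) ^ n\<close>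
  over the unit interval, which \<open>shifted_sum r n\<close> equals for \<open>r \<ge> 1\<close>, it multiplies the
  integrand by \<open>x = (1 + x) - 1\<close>.
\<close>
lemma shifted_sum_Suc:
  "shifted_sum (Suc r) n = shifted_sum r (Suc n) - shifted_sum r n"
proof -
  have "shifted_sum r n = (\<Sum>k\<le>Suc n. of_nat (n choose k) / of_nat (k + r))"
    by (simp add: shifted_sum_def)
  also have "\<dots> = 1 / of_nat r + (\<Sum>k\<le>n. of_nat (n choose Suc k) / of_nat (Suc k + r))"
    by (subst sum.atMost_Suc_shift) simp
  finally have "shifted_sum r n + shifted_sum (Suc r) n =
      1 / of_nat r + (\<Sum>k\<le>n. of_nat (Suc n choose Suc k) / of_nat (Suc k + r))"
    by (simp add: shifted_sum_def add_divide_distrib sum.distrib)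
  also have "\<dots> = shifted_sum r (Suc n)"
    unfolding shifted_sum_def
    by (subst sum.atMost_Suc_shift) (simp del: binomial_Suc_Suc)
  finally show ?thesis
    by simp
qed

lemma iterated_difference:
  fixes T :: "nat \<Rightarrow> nat \<Rightarrow> 'a::comm_ring_1"
  assumes "\<And>r n. T (Suc r) n = T r (Suc n) - T r n"
  shows "T r n = (\<Sum>j\<le>r. (-1) ^ (r + j) * of_nat (r choose j) * T 0 (n + j))"
proof (induction r arbitrary: n)
  case (Suc r)
  let ?t = "\<lambda>c j. (-1) ^ (r + j) * of_nat c * T 0 (n + j)"
  have 1: "T r (Suc n) = (\<Sum>j\<le>r. - ?t (r choose j) (Suc j))"
    by (subst Suc.IH) (simp add: mult.assoc)
  have "T r n = (\<Sum>j\<le>Suc r. ?t (r choose j) j)"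
    by (subst Suc.IH) (simp add: binomial_eq_0)
  also have "\<dots> = ?t 1 0 + (\<Sum>j\<le>r. ?t (r choose Suc j) (Suc j))"
    by (subst sum.atMost_Suc_shift) simp
  finally have "T (Suc r) n = - ?t 1 0 + (\<Sum>j\<le>r. - ?t (Suc r choose Suc j) (Suc j))"
    unfolding assms 1 by (simp add: sum_negf sum.distrib algebra_simps)
  also have "\<dots> = (\<Sum>j\<le>Suc r. - ?t (Suc r choose j) j)"
    by (subst sum.atMost_Suc_shift) (simp del: binomial_Suc_Suc)
  finally show ?case
    by simp
qed simp

text \<open>
  The difference recurrence is iterated \<open>r - 1\<close> times from \<open>shifted_sum 1\<close>, because \<open>shifted_sum 0\<close>
  contains the junk summand \<open>1 / 0\<close>; hence \<open>r - 1\<close> in the binomial coefficients.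
\<close>
lemma S_eq_binomial_sum:
  assumes "r \<ge> 1"
  shows "S r n = 2 ^ n - of_nat r * (\<Sum>j\<le>r - 1. (-1) ^ (r - 1 + j) * of_nat (r - 1 choose j) *
    ((2 ^ (n + j + 1) - 1) / of_nat (n + j + 1)))"
proof -
  have "shifted_sum (Suc (r - 1)) n = (\<Sum>j\<le>r - 1. (-1) ^ (r - 1 + j) * of_nat (r - 1 choose j) *
      shifted_sum (Suc 0) (n + j))"
    by (rule iterated_difference[where T = "\<lambda>r. shifted_sum (Suc r)"]) (rule shifted_sum_Suc)
  with assms show ?thesis
    using shifted_sum_1 by (simp add: S_eq_shifted_sum)
qed

section \<open>Prime factors larger than r\<close>

text \<open>
  Multiplying by the product \<open>Q\<close> of the other elements of the window clears every denominator
  except \<open>m\<close>. Neither \<open>r\<close>, nor \<open>Q\<close>, nor the binomial coefficient at \<open>m\<close> is divisible by \<open>p\<close>: the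
  elements of the window differ by less than \<open>r < p\<close>, and the binomial coefficient divides
  \<open>fact (r - 1)\<close>. So the factor \<open>p\<close> of the denominator \<open>m\<close> has to cancel against \<open>2 ^ m - 1\<close>.
\<close>
lemma prime_dvd_mersenne_of_S_Ints:
  assumes int: "S r n \<in> \<int>" and p: "prime p" "r < p" and m: "p dvd m" "n < m" "m \<le> n + r"
  shows "p dvd 2 ^ m - 1"
proof -
  have r: "r \<ge> 1"
    using m by linarith
  define j0 where "j0 = m - n - 1"
  have j0: "j0 \<le> r - 1" "n + j0 + 1 = m"
    using m by (auto simp: j0_def)
  define a :: "nat \<Rightarrow> int" where "a j = (-1) ^ (r - 1 + j) * int (r - 1 choose j)" for j
  define b where "b j = of_int (a j) * ((2 ^ (n + j + 1) - 1) / of_nat (n + j + 1) :: rat)" for j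
  define Q where "Q = (\<Prod>j\<in>{..r - 1} - {j0}. n + j + 1)"
  define R where "R = (\<Sum>j\<in>{..r - 1} - {j0}. b j)"
  have "S r n = 2 ^ n - of_nat r * (\<Sum>j\<le>r - 1. b j)"
    unfolding S_eq_binomial_sum[OF r] a_def b_def by simp
  also have "(\<Sum>j\<le>r - 1. b j) = b j0 + R"
    unfolding R_def using j0 by (subst sum.remove[of _ j0]) auto
  finally have "of_nat r * b j0 = 2 ^ n - S r n - of_nat r * R"
    by (simp add: algebra_simps)
  then have "of_nat Q * (of_nat r * b j0) = of_nat Q * (2 ^ n - S r n - of_nat r * R)"
    by (simp only:)
  then have S: "of_nat (r * Q) * b j0 = of_nat Q * (2 ^ n - S r n) - of_nat r * (of_nat Q * R)"
    by (simp add: algebra_simps)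
  have "of_nat Q * b j \<in> \<int>" if j: "j \<in> {..r - 1} - {j0}" for j
  proof -
    define M where "M = n + j + 1"
    have "M dvd Q"
      unfolding Q_def M_def using j by (intro dvd_prodI) auto
    then obtain q where q: "Q = M * q"
      by blast
    have "(of_nat M :: rat) \<noteq> 0"
      by (simp add: M_def del: of_nat_Suc)
    then have "of_nat Q * b j = of_int (int q * a j * (2 ^ M - 1))"
      unfolding q b_def M_def[symmetric] by simp
    then show ?thesis
      by (simp only: Ints_of_int)
  qed
  then have "of_nat Q * R \<in> \<int>"
    unfolding R_def sum_distrib_left by (rule Ints_sum)
  moreover have "2 ^ n - S r n \<in> \<int>"
    using int by (intro Ints_diff) auto
  ultimately have "of_nat (r * Q) * b j0 \<in> \<int>"
    unfolding S by (rule_tac Ints_diff[OF Ints_mult[OF Ints_of_nat] Ints_mult[OF Ints_of_nat]])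
  then obtain z where z: "of_nat (r * Q) * b j0 = of_int z"
    by (elim Ints_cases)
  have "(of_int (int (r * Q) * a j0 * (2 ^ m - 1)) :: rat) = of_nat m * (of_nat (r * Q) * b j0)"
    using m j0 by (simp add: b_def)
  also have "\<dots> = of_int (int m * z)"
    by (simp only: z of_int_mult of_int_of_nat_eq)
  finally have "int (r * Q) * a j0 * (2 ^ m - 1) = int m * z"
    by (simp only: of_int_eq_iff)
  then have "int p dvd int (r * Q) * a j0 * (2 ^ m - 1)"
    using m by (simp add: dvd_mult2)
  moreover have "prime (int p)"
    using p by simp
  moreover have "\<not> int p dvd int r"
    using p r by (auto dest: dvd_imp_le)
  moreover have "\<not> int p dvd int Q"
  proof
    assume "int p dvd int Q"
    then have "p dvd Q"
      by (simp only: int_dvd_int_iff)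
    then obtain j where j: "j \<le> r - 1" "j \<noteq> j0" "p dvd n + j + 1"
      using p by (auto simp: Q_def prime_dvd_prod_iff)
    have "p dvd (n + j + 1) - m" "p dvd m - (n + j + 1)"
      using j m by (auto intro: dvd_diff_nat)
    moreover have "n + j + 1 - m \<noteq> 0 \<or> m - (n + j + 1) \<noteq> 0"
      using j j0 by auto
    ultimately have "p \<le> n + j + 1 - m \<or> p \<le> m - (n + j + 1)"
      using dvd_imp_le by blast
    then show False
      using j j0 p by auto
  qed
  moreover have "\<not> int p dvd a j0"
  proof
    assume "int p dvd a j0"
    then have "p dvd (r - 1 choose j0)"
      by (simp add: a_def dvd_mult_unit_iff' is_unit_power_iff)
    also have "(r - 1 choose j0) dvd fact (r - 1)"
      using binomial_fact_lemma[OF j0(1)] by (metis dvd_triv_right)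
    finally show False
      using p by (simp add: prime_dvd_fact_iff)
  qed
  ultimately have "int p dvd 2 ^ m - 1"
    by (simp add: prime_dvd_mult_iff)
  then have "int p dvd int (2 ^ m - 1)"
    by (simp add: of_nat_diff)
  then show ?thesis
    by (simp only: int_dvd_int_iff)
qed

text \<open>
  The witness is the order of 2 modulo \<open>p\<close>. It divides \<open>p - 1\<close>, so its prime factors lie below \<open>p\<close>,
  where the prime factors of \<open>m\<close> are at most \<open>r\<close>. The lemma thus replaces \<open>m\<close> by an
  \<open>r\<close>-smooth divisor.
\<close>
lemma smooth_dvd_of_prime_dvd_mersenne:
  fixes m p :: nat
  assumes "m \<noteq> 0" and p: "prime p" "p dvd 2 ^ m - 1"
    and minimal: "\<And>q. prime q \<Longrightarrow> q dvd m \<Longrightarrow> q < p \<Longrightarrow> q \<le> r"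
  obtains k where "k dvd m" "p dvd 2 ^ k - 1" "\<And>q. prime q \<Longrightarrow> q dvd k \<Longrightarrow> q \<le> r"
proof -
  have iff: "p dvd 2 ^ k - 1 \<longleftrightarrow> ord p 2 dvd k" for k
    using cong_altdef_nat[of 1 "2 ^ k" p] by (simp add: ord_divides[symmetric])
  have "odd p"
  proof
    assume "even p"
    then have "even (2 ^ m - 1 :: nat)"
      using p(2) dvd_trans by blast
    with \<open>m \<noteq> 0\<close> show False
      by simp
  qed
  then have "coprime p 2"
    by simp
  then have "ord p 2 dvd p - 1"
    using order_divides_totient[of p 2] p by (simp add: totient_prime)
  show ?thesis
  proof
    show m: "ord p 2 dvd m"
      using p iff by simp
    show "p dvd 2 ^ ord p 2 - 1"
      using iff by simp
    fix q assume q: "prime q" "q dvd ord p 2"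
    have "q \<le> p - 1"
      using \<open>ord p 2 dvd p - 1\<close> q(2) prime_gt_1_nat[OF p(1)] by (intro dvd_imp_le) (auto elim: dvd_trans)
    then have "q < p"
      using prime_gt_1_nat[OF p(1)] by simp
    moreover have "q dvd m"
      using q m dvd_trans by blast
    ultimately show "q \<le> r"
      using minimal q by blast
  qed
qed

text \<open>
  If \<open>m\<close> is divisible by no element of \<open>D\<close>, the same holds for each of its divisors, in particular
  for the order of 2 modulo a prime factor of \<open>m\<close>. The set \<open>G\<close> contains all \<open>r\<close>-smooth numbers with
  this property. As \<open>m\<close> is not in \<open>G\<close>, it has a prime factor above \<open>r\<close>, and the smallest such factor
  gives the contradiction.
\<close>
lemma S_notin_Ints_of_escape:
  assumes m: "n < m" "m \<le> n + r" and escape: "\<And>d. d \<in> D \<Longrightarrow> \<not> d dvd m"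
    and smooth: "\<And>k. k > 0 \<Longrightarrow> (\<And>q. prime q \<Longrightarrow> q dvd k \<Longrightarrow> q \<le> r) \<Longrightarrow>
      (\<And>d. d \<in> D \<Longrightarrow> \<not> d dvd k) \<Longrightarrow> k \<in> G"
    and mersenne: "\<And>k p. k \<in> G \<Longrightarrow> prime p \<Longrightarrow> p dvd 2 ^ k - 1 \<Longrightarrow> p \<le> r"
    and "m \<notin> G"
  shows "S r n \<notin> \<int>"
proof
  assume int: "S r n \<in> \<int>"
  define p where "p = (LEAST q. prime q \<and> q dvd m \<and> r < q)"
  have "\<exists>q. prime q \<and> q dvd m \<and> r < q"
  proof (rule ccontr)
    assume "\<nexists>q. prime q \<and> q dvd m \<and> r < q"
    then have "m \<in> G"
      using m escape by (intro smooth) (auto simp: not_less)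
    with \<open>m \<notin> G\<close> show False
      by simp
  qed
  then have "prime p \<and> p dvd m \<and> r < p"
    unfolding p_def by (rule LeastI_ex)
  then have p: "prime p" "p dvd m" "r < p"
    by simp_all
  have minimal: "q \<le> r" if "prime q" "q dvd m" "q < p" for q
    using not_less_Least[of q "\<lambda>q. prime q \<and> q dvd m \<and> r < q"] that
    unfolding p_def by auto
  have "p dvd 2 ^ m - 1"
    using prime_dvd_mersenne_of_S_Ints[OF int p(1,3,2) m] .
  then obtain k where k: "k dvd m" "p dvd 2 ^ k - 1" "\<And>q. prime q \<Longrightarrow> q dvd k \<Longrightarrow> q \<le> r"
    using smooth_dvd_of_prime_dvd_mersenne[of m p r] p minimal m by auto
  have "k > 0"
    using k(1) m by (auto intro: Nat.gr0I)
  moreover have "\<not> d dvd k" if "d \<in> D" for d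
    using escape[OF that] k(1) dvd_trans by blast
  ultimately have "k \<in> G"
    using smooth k(3) by blast
  then have "p \<le> r"
    using mersenne p k by blast
  with p show False
    by simp
qed

text \<open>
  If \<open>m\<close> has no prime factor up to \<open>r\<close>, the order of 2 in question is 1, and no prime divides
  \<open>2 ^ 1 - 1\<close>. For \<open>r = 1\<close> every \<open>m > 1\<close> qualifies, and the
  argument is the classical one that such an \<open>m\<close> never divides \<open>2 ^ m - 1\<close>.
\<close>
lemma S_notin_Ints_of_rough:
  assumes "1 < m" and m: "n < m" "m \<le> n + r" and rough: "\<And>q. prime q \<Longrightarrow> q dvd m \<Longrightarrow> r < q"
  shows "S r n \<notin> \<int>"
proof (rule S_notin_Ints_of_escape[where m = m])
  show "k \<in> {1}" if "k > 0" "\<And>q. prime q \<Longrightarrow> q dvd k \<Longrightarrow> q \<le> r"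
    "\<And>d. d \<in> {q. prime q \<and> q \<le> r} \<Longrightarrow> \<not> d dvd k" for k
    using that(2,3) prime_factor_nat[of k] by auto
  show "\<not> d dvd m" if "d \<in> {q. prime q \<and> q \<le> r}" for d
    using rough[of d] that by auto
qed (use assms(1) m in auto)

lemma S_notin_Ints_of_le_2:
  assumes "1 \<le> r" "r \<le> 2" "1 \<le> n"
  shows "S r n \<notin> \<int>"
proof -
  define m where "m = (if r = 2 \<and> even (n + 1) then n + 2 else n + 1)"
  show ?thesis
  proof (rule S_notin_Ints_of_rough[where m = m])
    fix q assume q: "prime q" "q dvd m"
    show "r < q"
    proof (rule ccontr)
      assume "\<not> r < q"
      with q(1) assms have "r = 2" "q = 2"
        using prime_ge_2_nat[of q] by auto
      with q(2) show False
        by (auto simp: m_def split: if_splits)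
    qed
  qed (use assms in \<open>auto simp: m_def\<close>)
qed

section \<open>Windows starting below r\<close>

text \<open>
  A prime in the window that exceeds \<open>r\<close> is rough. The gaps between primes up to 23 are so short that
  such a prime is missing only for \<open>n \<le> 3\<close>; then \<open>S r n\<close> lies strictly between 0 and 1, except that
  \<open>S 7 3 = 161 / 120\<close>.
\<close>
lemma S_notin_Ints_of_less:
  assumes "1 \<le> n" "n < r" "r \<le> 22"
  shows "S r n \<notin> \<int>"
proof (cases "\<exists>p. prime p \<and> r < p \<and> p \<le> n + r")
  case True
  then obtain p where "prime p" "r < p" "p \<le> n + r"
    by blast
  with assms show ?thesis
    by (intro S_notin_Ints_of_rough[of p]) (auto dest: primes_dvd_imp_eq simp: prime_gt_1_nat)
next
  case False
  then have gap: "\<not> prime p" if "r < p" "p \<le> n + r" for p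
    using that by blast
  have fraction: "x \<notin> \<int>" if "of_int k < x" "x < of_int (k + 1)" for x :: rat and k
    using that by (auto elim!: Ints_cases)
  have "\<forall>r\<in>set [2..<23 :: nat]. \<exists>p\<in>set [r + 1..<r + 5]. prime p"
    by code_simp
  moreover have "r \<in> set [2..<23]"
    unfolding set_upt using assms by simp
  ultimately obtain p where p: "prime p" "p \<in> set [r + 1..<r + 5]"
    by blast
  then have "n < 4"
    using gap[of p] unfolding set_upt by force
  with assms consider "n = 1" | "n = 2" | "n = 3"
    by linarith
  then show ?thesis
  proof cases
    case 1
    show ?thesis
      using assms 1 by (intro fraction[of 0]) (simp_all add: S_def field_simps)
  next
    case 2
    have S: "S r n = 2 / of_nat (r + 1) + 2 / of_nat (r + 2)"
      using 2 by (simp add: S_def numeral_eq_Suc add_ac)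
    have "r \<noteq> 3"
      using gap[of 5] 2 by auto
    with assms 2 have r: "4 \<le> r"
      by simp
    have "(2 / of_nat (r + 1) :: rat) \<le> 2 / 5" "(2 / of_nat (r + 2) :: rat) \<le> 2 / 6"
      using r by (intro divide_left_mono; simp)+
    moreover have "(2 / of_nat (r + 1) :: rat) > 0" "(2 / of_nat (r + 2) :: rat) > 0"
      by simp_all
    ultimately have "0 < S r n" "S r n < 1"
      unfolding S by linarith+
    then show ?thesis
      by (intro fraction[of 0]) simp_all
  next
    case 3
    have S: "S r n = 3 / of_nat (r + 1) + 6 / of_nat (r + 2) + 3 / of_nat (r + 3)"
      using 3 by (simp add: S_def numeral_eq_Suc add_ac)
    show ?thesis
    proof (cases "r = 7")
      case True
      with S have "S r n = 161 / 120"
        by simp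
      then show ?thesis
        by (intro fraction[of 1]) simp_all
    next
      case False
      have "\<not> r < 12"
      proof
        assume "r < 12"
        have "\<forall>r\<in>set [4..<12 :: nat]. r = 7 \<or> (\<exists>p\<in>set [r + 1..<r + 4]. prime p)"
          by code_simp
        moreover have "r \<in> set [4..<12]"
          unfolding set_upt using assms 3 \<open>r < 12\<close> by simp
        ultimately obtain p where "prime p" "p \<in> set [r + 1..<r + 4]"
          using False by blast
        then show False
          using gap[of p] 3 unfolding set_upt by force
      qed
      then have "(3 / of_nat (r + 1) :: rat) \<le> 3 / 13" "(6 / of_nat (r + 2) :: rat) \<le> 6 / 14"
        "(3 / of_nat (r + 3) :: rat) \<le> 3 / 15"
        by (intro divide_left_mono; simp)+
      moreover have "(3 / of_nat (r + 1) :: rat) > 0" "(6 / of_nat (r + 2) :: rat) > 0"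
        "(3 / of_nat (r + 3) :: rat) > 0"
        by simp_all
      ultimately have "0 < S r n" "S r n < 1"
        unfolding S by linarith+
      then show ?thesis
        by (intro fraction[of 0]) simp_all
    qed
  qed
qed

section \<open>Windows that are not covered by multiples\<close>

lemma card_multiples_in_window:
  fixes d :: nat
  shows "card {i \<in> {1..w}. d dvd n + i} \<le> (w - 1) div d + 1"
proof (cases "{i \<in> {1..w}. d dvd n + i} = {}")
  case True
  show ?thesis
    unfolding True by simp
next
  case False
  let ?A = "{i \<in> {1..w}. d dvd n + i}"
  define i0 where "i0 = Min ?A"
  have fin: "finite ?A"
    by simp
  have i0: "i0 \<in> ?A"
    unfolding i0_def using fin False by (rule Min_in)
  have "?A \<subseteq> (\<lambda>k. i0 + k * d) ` {..(w - 1) div d}"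
  proof
    fix i assume i: "i \<in> ?A"
    have le: "i0 \<le> i"
      unfolding i0_def using fin i by (rule Min_le)
    have "d dvd (n + i) - (n + i0)"
      using i i0 by (intro dvd_diff_nat) auto
    then have "(i - i0) div d * d = i - i0"
      by simp
    with le have "i = i0 + (i - i0) div d * d"
      by simp
    moreover have "(i - i0) div d \<le> (w - 1) div d"
      using i i0 by (intro div_le_mono) auto
    ultimately show "i \<in> (\<lambda>k. i0 + k * d) ` {..(w - 1) div d}"
      by blast
  qed
  then have "card ?A \<le> card {..(w - 1) div d}"
    by (rule surj_card_le[rotated]) simp
  then show ?thesis
    by simp
qed

text \<open>
  A sufficient test for the claim that multiples of \<open>ds\<close> cannot cover all positions \<open>xs\<close> of a
  window of length \<open>w\<close>, wherever the window starts. The first disjunct is a counting bound, which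
  prunes the search; the second branches over the residue \<open>c\<close> of the start of the window modulo \<open>d\<close>
  and drops the positions that the multiples of \<open>d\<close> hit. Residues for different moduli are treated as
  independent, even if the moduli are not coprime; this can only make the test fail more often.
\<close>
fun escapes :: "nat \<Rightarrow> nat list \<Rightarrow> nat list \<Rightarrow> bool" where
  "escapes w [] xs \<longleftrightarrow> xs \<noteq> []"
| "escapes w (d # ds) xs \<longleftrightarrow>
     (\<Sum>e\<leftarrow>d # ds. (w - 1) div e + 1) < length xs \<or>
     (\<forall>c\<in>set [0..<d]. escapes w ds (filter (\<lambda>i. \<not> d dvd c + i) xs))"

lemma few_multiples_escape:
  fixes ds :: "nat list"
  assumes "(\<Sum>d\<leftarrow>ds. (w - 1) div d + 1) < card X" "X \<subseteq> {1..w}"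
  shows "\<exists>i\<in>X. \<forall>d\<in>set ds. \<not> d dvd n + i"
  using assms
proof (induction ds arbitrary: X)
  case Nil
  then show ?case
    by (auto simp: card_gt_0_iff)
next
  case (Cons d ds)
  let ?Y = "X - {i \<in> {1..w}. d dvd n + i}"
  have "card X - card {i \<in> {1..w}. d dvd n + i} \<le> card ?Y"
    by (rule diff_card_le_card_Diff) simp
  with Cons.prems card_multiples_in_window[of w d n]
  have "(\<Sum>d\<leftarrow>ds. (w - 1) div d + 1) < card ?Y"
    by simp
  with Cons.IH[of ?Y] Cons.prems obtain i where "i \<in> ?Y" "\<forall>d\<in>set ds. \<not> d dvd n + i"
    by auto
  with Cons.prems show ?case
    by auto
qed

lemma escapes_sound:
  assumes "escapes w ds xs" "distinct xs" "set xs \<subseteq> {1..w}" "0 \<notin> set ds"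
  shows "\<exists>i\<in>set xs. \<forall>d\<in>set ds. \<not> d dvd n + i"
  using assms
proof (induction ds arbitrary: xs)
  case Nil
  then show ?case
    by (cases xs) auto
next
  case (Cons d ds)
  show ?case
  proof (cases "(\<Sum>e\<leftarrow>d # ds. (w - 1) div e + 1) < length xs")
    case True
    with Cons.prems few_multiples_escape[of w "d # ds" "set xs" n] show ?thesis
      by (simp add: distinct_card)
  next
    case False
    let ?ys = "filter (\<lambda>i. \<not> d dvd n mod d + i) xs"
    have "n mod d \<in> set [0..<d]"
      using Cons.prems by simp
    with False Cons.prems have "escapes w ds ?ys"
      by auto
    then have "\<exists>i\<in>set ?ys. \<forall>d\<in>set ds. \<not> d dvd n + i"
      using Cons.prems by (intro Cons.IH) auto
    then show ?thesis
      by (auto simp: dvd_eq_mod_eq_0 mod_add_left_eq)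
  qed
qed

text \<open>
  The escaping numbers of interest have only the prime factors 2 and 3, since the larger primes up to
  \<open>r\<close> are among the moduli, and escaping 16 and 9 bounds the exponents by 3 and 1.
\<close>
lemma three_smooth_dvd_24:
  fixes k :: nat
  assumes "k > 0" and primes: "\<And>q. prime q \<Longrightarrow> q dvd k \<Longrightarrow> q < 5" and "\<not> 16 dvd k" "\<not> 9 dvd k"
  shows "k dvd 24"
proof -
  define a where "a = multiplicity 2 k"
  obtain x where a: "k = 2 ^ a * x" "\<not> 2 dvd x"
    using assms(1) by (rule_tac multiplicity_decompose'[of k 2]) (auto simp: a_def)
  then have "x \<noteq> 0"
    by (metis dvd_0_right)
  define b where "b = multiplicity 3 x"
  obtain y where b: "x = 3 ^ b * y" "\<not> 3 dvd y"
    using \<open>x \<noteq> 0\<close> by (rule_tac multiplicity_decompose'[of x 3]) (auto simp: b_def)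
  have "y = 1"
  proof (rule ccontr)
    assume "y \<noteq> 1"
    then obtain q where q: "prime q" "q dvd y"
      using prime_factor_nat by auto
    then have "q < 5" "q \<noteq> 2" "q \<noteq> 3"
      using primes[of q] a b by auto
    moreover have "q \<noteq> 4"
      using q(1) primes_dvd_imp_eq[of 2 q] by auto
    ultimately show False
      using prime_ge_2_nat[OF q(1)] by linarith
  qed
  have "a \<le> 3"
  proof (rule ccontr)
    assume "\<not> a \<le> 3"
    then have "(2::nat) ^ 4 dvd 2 ^ a"
      by (intro le_imp_power_dvd) simp
    with assms(3) a show False
      by (simp add: dvd_mult2)
  qed
  moreover have "b \<le> 1"
  proof (rule ccontr)
    assume "\<not> b \<le> 1"
    then have "(3::nat) ^ 2 dvd 3 ^ b"
      by (intro le_imp_power_dvd) simp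
    with assms(4) a b show False
      by (simp add: dvd_mult dvd_mult2)
  qed
  ultimately have "2 ^ a * 3 ^ b dvd (2 ^ 3 * 3 ^ 1 :: nat)"
    by (intro mult_dvd_mono le_imp_power_dvd)
  with a b \<open>y = 1\<close> show ?thesis
    by simp
qed

text \<open>
  The window length \<open>w\<close> in the covering check may be smaller than \<open>r\<close>: one check serves all \<open>r\<close> that
  have the same list of moduli. As 24 always has a divisor among the moduli, the possible orders of 2
  are the proper divisors of 24. The last assumption together with \<open>r \<le> n\<close> ensures that the element
  found in the window is not itself such a divisor, hence has a prime factor above \<open>r\<close>.
\<close>
lemma S_notin_Ints_of_covering:
  assumes "w \<le> r" and n: "r \<le> n" and escapes: "escapes w ds [1..<w + 1]" "0 \<notin> set ds"
    and ds: "\<exists>d\<in>set ds. d dvd 16" "\<exists>d\<in>set ds. d dvd 9" "\<exists>d\<in>set ds. d dvd 24"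
      "\<And>q. prime q \<Longrightarrow> 5 \<le> q \<Longrightarrow> q \<le> r \<Longrightarrow> q \<in> set ds"
    and mersenne: "\<And>k p. k \<in> {1, 2, 3, 4, 6, 8, 12} \<Longrightarrow> \<forall>d\<in>set ds. \<not> d dvd k \<Longrightarrow>
      prime p \<Longrightarrow> p dvd 2 ^ k - 1 \<Longrightarrow> p \<le> r"
    and small: "\<And>k. k \<in> {1, 2, 3, 4, 6, 8, 12} \<Longrightarrow> \<forall>d\<in>set ds. \<not> d dvd k \<Longrightarrow> k \<le> r"
  shows "S r n \<notin> \<int>"
proof -
  have "\<exists>i\<in>set [1..<w + 1]. \<forall>d\<in>set ds. \<not> d dvd n + i"
    using escapes by (intro escapes_sound) auto
  then obtain i where i: "1 \<le> i" "i \<le> w" "\<forall>d\<in>set ds. \<not> d dvd n + i"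
    by auto
  define G where "G = {k \<in> {1, 2, 3, 4, 6, 8, 12}. \<forall>d\<in>set ds. \<not> d dvd k}"
  show ?thesis
  proof (rule S_notin_Ints_of_escape)
    show "k \<in> G" if k: "k > 0" "\<And>q. prime q \<Longrightarrow> q dvd k \<Longrightarrow> q \<le> r" "\<And>d. d \<in> set ds \<Longrightarrow> \<not> d dvd k" for k
    proof -
      have "q < 5" if "prime q" "q dvd k" for q
        using that ds(4)[of q] k by (meson not_le)
      moreover have "\<not> 16 dvd k" "\<not> 9 dvd k" "\<not> 24 dvd k"
        using k(3) ds(1-3) by (meson dvd_trans)+
      ultimately have "k dvd 24" "k \<noteq> 24"
        using three_smooth_dvd_24[OF k(1)] by auto
      moreover have "\<forall>k\<in>set [0..<25]. k dvd 24 \<and> k \<noteq> 24 \<longrightarrow> k \<in> set [1, 2, 3, 4, 6, 8, 12]"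
        by code_simp
      moreover have "k \<in> set [0..<25]"
        using dvd_imp_le[OF \<open>k dvd 24\<close>] by simp
      ultimately have "k \<in> set [1, 2, 3, 4, 6, 8, 12]"
        by blast
      then show ?thesis
        using k(3) by (simp add: G_def)
    qed
    show "n + i \<notin> G"
      using n i(1) small[of "n + i"] by (auto simp: G_def)
  qed (use assms(1) i mersenne in \<open>auto simp: G_def\<close>)
qed

section \<open>The covering checks\<close>

lemma prime_between_5_and_22:
  assumes "prime q" "5 \<le> q" "q \<le> 22"
  shows "q \<in> {5, 7, 11, 13, 17, 19 :: nat}"
proof -
  have "\<forall>q\<in>set [5..<23 :: nat]. prime q \<longrightarrow> q \<in> set [5, 7, 11, 13, 17, 19]"
    by code_simp
  moreover have "q \<in> set [5..<23]"
    unfolding set_upt using assms by simp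
  ultimately have "q \<in> set [5, 7, 11, 13, 17, 19]"
    using assms(1) by blast
  then show ?thesis
    by simp
qed

lemma prime_dvd_mersenne_number:
  fixes p :: nat
  assumes "prime p"
  shows "p dvd 3 \<Longrightarrow> p = 3" "p dvd 7 \<Longrightarrow> p = 7"
    "p dvd 15 \<Longrightarrow> p \<in> {3, 5}" "p dvd 63 \<Longrightarrow> p \<in> {3, 7}"
    "p dvd 255 \<Longrightarrow> p \<in> {3, 5, 17}" "p dvd 4095 \<Longrightarrow> p \<in> {3, 5, 7, 13}"
proof -
  have dvd: "p = q" if "prime q" "p dvd q" for q
    using that assms by (simp add: primes_dvd_imp_eq)
  have primes: "prime (3::nat)" "prime (5::nat)" "prime (7::nat)" "prime (13::nat)" "prime (17::nat)"
    by simp_all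
  note [dest] = dvd[OF primes(1)] dvd[OF primes(2)] dvd[OF primes(3)] dvd[OF primes(4)] dvd[OF primes(5)]
  have eq: "15 = (3 * 5 :: nat)" "63 = (3 * (3 * 7) :: nat)" "255 = (3 * (5 * 17) :: nat)"
    "4095 = (3 * (3 * (5 * (7 * 13))) :: nat)"
    by simp_all
  show "p dvd 3 \<Longrightarrow> p = 3" "p dvd 7 \<Longrightarrow> p = 7"
    "p dvd 15 \<Longrightarrow> p \<in> {3, 5}" "p dvd 63 \<Longrightarrow> p \<in> {3, 7}"
    "p dvd 255 \<Longrightarrow> p \<in> {3, 5, 17}" "p dvd 4095 \<Longrightarrow> p \<in> {3, 5, 7, 13}"
    unfolding eq prime_dvd_mult_iff[OF assms] by blast+
qed

text \<open>
  The lengths are the odd primes up to 19, at which the list of moduli changes. The powers of 2 and the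
  numbers \<open>2 ^ a * 3\<close> exclude exactly those divisors \<open>k\<close> of 24 for which \<open>2 ^ k - 1\<close> has a prime
  factor above \<open>r\<close>: the factors 5, 7, 13 and 17 of \<open>2 ^ 4 - 1\<close>, \<open>2 ^ 3 - 1\<close>, \<open>2 ^ 12 - 1\<close> and \<open>2 ^ 8 - 1\<close> are the
  reason why 4, 3, 12 and 8 become possible orders from \<open>r = 5\<close>, 7, 13 and 17 on. In the lists for 11,
  17 and 19 counting alone fails. They start with moduli for which few residues attain the maximal
  number of multiples, so that counting soon settles most branches.
\<close>
lemma escapes_initial_windows:
  "escapes 3 [4, 3] [1..<3 + 1]"
  "escapes 5 [8, 3, 5] [1..<5 + 1]"
  "escapes 7 [8, 12, 9, 5, 7] [1..<7 + 1]"
  "escapes 11 [5, 9, 7, 8, 12, 11] [1..<11 + 1]"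
  "escapes 13 [8, 9, 5, 7, 11, 13] [1..<13 + 1]"
  "escapes 17 [16, 5, 7, 9, 24, 11, 13, 17] [1..<17 + 1]"
  "escapes 19 [9, 16, 17, 5, 7, 19, 24, 13, 11] [1..<19 + 1]"
  by code_simp+

theorem theorem1p2:
  fixes r n :: nat
  assumes "1 \<le> r" and "r \<le> 22" and "1 \<le> n"
  shows "S r n \<notin> \<int>"
proof (cases "n < r")
  case True
  with assms show ?thesis
    by (intro S_notin_Ints_of_less)
next
  case False
  then have n: "r \<le> n"
    by simp
  note primes = prime_between_5_and_22[OF _ _ order_trans[OF _ \<open>r \<le> 22\<close>]]
  consider "r \<le> 2" | "3 \<le> r" "r < 5" | "5 \<le> r" "r < 7" | "7 \<le> r" "r < 11" | "11 \<le> r" "r < 13"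
    | "13 \<le> r" "r < 17" | "17 \<le> r" "r < 19" | "19 \<le> r"
    by linarith
  then show ?thesis
  proof cases
    case 1
    with assms show ?thesis
      by (intro S_notin_Ints_of_le_2)
  next
    case 2
    show ?thesis
      by (rule S_notin_Ints_of_covering[OF 2(1) n escapes_initial_windows(1)])
        (use 2 in \<open>auto dest: primes prime_dvd_mersenne_number\<close>)
  next
    case 3
    show ?thesis
      by (rule S_notin_Ints_of_covering[OF 3(1) n escapes_initial_windows(2)])
        (use 3 in \<open>auto dest: primes prime_dvd_mersenne_number\<close>)
  next
    case 4
    show ?thesis
      by (rule S_notin_Ints_of_covering[OF 4(1) n escapes_initial_windows(3)])
        (use 4 in \<open>auto dest: primes prime_dvd_mersenne_number\<close>)
  next
    case 5
    show ?thesis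
      by (rule S_notin_Ints_of_covering[OF 5(1) n escapes_initial_windows(4)])
        (use 5 in \<open>auto dest: primes prime_dvd_mersenne_number\<close>)
  next
    case 6
    show ?thesis
      by (rule S_notin_Ints_of_covering[OF 6(1) n escapes_initial_windows(5)])
        (use 6 in \<open>auto dest: primes prime_dvd_mersenne_number\<close>)
  next
    case 7
    show ?thesis
      by (rule S_notin_Ints_of_covering[OF 7(1) n escapes_initial_windows(6)])
        (use 7 in \<open>auto dest: primes prime_dvd_mersenne_number\<close>)
  next
    case 8
    show ?thesis
      by (rule S_notin_Ints_of_covering[OF 8 n escapes_initial_windows(7)])
        (use 8 in \<open>auto dest: primes prime_dvd_mersenne_number\<close>)
  qed
qed

end
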